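(* Let $d\ge1$. Let $\alpha,\beta,\gamma\in\mathbb R\setminus\{0\}$ and $s\in\mathbb R$ satisfy $\beta+\gamma=0$. Then the flow map of the system $$(i\partial_t+\alpha\Delta)u=-(\nabla\cdot w)v,\quad (i\partial_t+\beta\Delta)v=-(\nabla\cdot\overline w)u,\quad (i\partial_t+\gamma\Delta)w=\nabla(u\cdot\overline v)\qquad (t>0,\ x\in\mathbb T^d)$$ is discontinuous in $\mathcal H^s(\mathbb T^d)$.
   Context: $\mathbb T=\mathbb R/2\pi\mathbb Z$; $u,v,w$ are $\mathbb C^d$-valued; $u\cdot\overline v=\sum_ju_j\overline{v_j}$. $\mathcal H^s(\mathbb T^d)=(H^s(\mathbb T^d))^d\times(H^s(\mathbb T^d))^d\times(H^s(\mathbb T^d))^d$. The flow map sends initial data $(u(0),v(0),w(0))$ to the solution $(u,v,w)$. Its discontinuity in $\mathcal H^s$ means: for every $T>0$ there exist a classical (smooth) solution $(\tilde u,\tilde v,\tilde w)$ and a sequence of classical solutions $(u_n,v_n,w_n)$ of the system on $[0,T]$ such that $\|(u_n(0),v_n(0),w_n(0))-(\tilde u(0),\tilde v(0),\tilde w(0))\|_{\mathcal H^s}\to0$ while $\sup_{0\le t\le T}\|(u_n(t),v_n(t),w_n(t))-(\tilde u(t),\tilde v(t),\tilde w(t))\|_{\mathcal H^s}\not\to0$ as $n\to\infty$. *)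

theory Defs
  imports "HOL-Analysis.Analysis"
begin

text \<open>
  Functions on the torus \<open>(\<real>/2\<pi>\<int>)\<^sup>d\<close>, \<open>d = CARD('n)\<close>, are represented by functions on \<^typ>\<open>real ^ 'n\<close>
  that are \<open>2\<pi>\<close>-periodic in every coordinate.
\<close>

definition torus_periodic :: "(real ^ 'n \<Rightarrow> 'b) \<Rightarrow> bool" where
  "torus_periodic f \<longleftrightarrow> (\<forall>x j. f (x + (2 * pi) *\<^sub>R axis j 1) = f x)"

text \<open>
  \<open>C\<^sup>m\<close> regularity on a set, with derivatives taken relative to the set. It is only used on
  \<open>[0,T] \<times> \<real>\<^sup>d\<close> with \<open>T > 0\<close>, where these derivatives are unique (one-sided in time at the endpoints).
\<close>

primrec Ck_on :: "nat \<Rightarrow> 'a::real_normed_vector set \<Rightarrow> ('a \<Rightarrow> 'b::real_normed_vector) \<Rightarrow> bool" where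
  "Ck_on 0 S f \<longleftrightarrow> continuous_on S f"
| "Ck_on (Suc m) S f \<longleftrightarrow>
     (\<exists>f'. (\<forall>x\<in>S. (f has_derivative f' x) (at x within S)) \<and> (\<forall>h. Ck_on m S (\<lambda>x. f' x h)))"

definition smooth_on :: "'a::real_normed_vector set \<Rightarrow> ('a \<Rightarrow> 'b::real_normed_vector) \<Rightarrow> bool" where
  "smooth_on S f \<longleftrightarrow> (\<forall>m. Ck_on m S f)"

definition partial :: "'n \<Rightarrow> (real ^ 'n \<Rightarrow> 'b::real_normed_vector) \<Rightarrow> real ^ 'n \<Rightarrow> 'b" where
  "partial j f x = vector_derivative (\<lambda>h. f (x + h *\<^sub>R axis j 1)) (at 0)"

definition laplacian :: "(real ^ 'n \<Rightarrow> 'b::real_normed_vector) \<Rightarrow> real ^ 'n \<Rightarrow> 'b" where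
  "laplacian f x = (\<Sum>j\<in>UNIV. partial j (partial j f) x)"

definition divergence :: "(real ^ 'n \<Rightarrow> complex ^ 'n) \<Rightarrow> real ^ 'n \<Rightarrow> complex" where
  "divergence f x = (\<Sum>j\<in>UNIV. partial j (\<lambda>y. f y $ j) x)"

definition gradient :: "(real ^ 'n \<Rightarrow> complex) \<Rightarrow> real ^ 'n \<Rightarrow> complex ^ 'n" where
  "gradient f x = (\<chi> j. partial j f x)"

definition vcnj :: "complex ^ 'n \<Rightarrow> complex ^ 'n" where
  "vcnj z = (\<chi> j. cnj (z $ j))"

text \<open>The bilinear product, without conjugation (unlike \<open>inner\<close>, which is moreover real-valued).\<close>

definition cdot :: "complex ^ 'n \<Rightarrow> complex ^ 'n \<Rightarrow> complex" where
  "cdot z z' = (\<Sum>j\<in>UNIV. z $ j * z' $ j)"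

definition fourier_coeff :: "(real ^ 'n \<Rightarrow> complex ^ 'n) \<Rightarrow> int ^ 'n \<Rightarrow> complex ^ 'n" where
  "fourier_coeff f k =
     (1 / (2 * pi) ^ CARD('n)) *\<^sub>R
     integral (cbox 0 (\<chi> j. 2 * pi)) (\<lambda>x. cis (- (\<Sum>j\<in>UNIV. of_int (k $ j) * x $ j)) *s f x)"

text \<open>
  The norm of \<open>(H\<^sup>s)\<^sup>d\<close>, equal to \<open>\<infinity>\<close> when the defining series diverges. Since the norm of
  \<^typ>\<open>complex ^ 'n\<close> is Euclidean, this is the \<open>\<ell>\<^sup>2\<close>-sum of the \<open>H\<^sup>s\<close> norms of the components.
\<close>

definition sobolev_weight :: "real \<Rightarrow> (real ^ 'n \<Rightarrow> complex ^ 'n) \<Rightarrow> int ^ 'n \<Rightarrow> real" where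
  "sobolev_weight s f k =
     (1 + (\<Sum>j\<in>UNIV. (of_int (k $ j))\<^sup>2)) powr s * (norm (fourier_coeff f k))\<^sup>2"

definition Hs_norm :: "real \<Rightarrow> (real ^ 'n \<Rightarrow> complex ^ 'n) \<Rightarrow> ennreal" where
  "Hs_norm s f =
     (if sobolev_weight s f summable_on UNIV
      then ennreal (sqrt (\<Sum>\<^sub>\<infinity>k. sobolev_weight s f k)) else \<infinity>)"

type_synonym 'n field = "real \<Rightarrow> real ^ 'n \<Rightarrow> complex ^ 'n"

type_synonym 'n state = "'n field \<times> 'n field \<times> 'n field"

definition state_dist :: "real \<Rightarrow> real \<Rightarrow> 'n state \<Rightarrow> 'n::finite state \<Rightarrow> ennreal" where
  "state_dist s t = (\<lambda>(u, v, w) (u', v', w').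
     Hs_norm s (\<lambda>x. u t x - u' t x) + Hs_norm s (\<lambda>x. v t x - v' t x) + Hs_norm s (\<lambda>x. w t x - w' t x))"

definition smooth_field :: "real \<Rightarrow> 'n::finite field \<Rightarrow> bool" where
  "smooth_field T u \<longleftrightarrow>
     smooth_on ({0..T} \<times> UNIV) (\<lambda>(t, x). u t x) \<and> (\<forall>t\<in>{0..T}. torus_periodic (u t))"

definition classical_solution ::
    "real \<Rightarrow> real \<Rightarrow> real \<Rightarrow> real \<Rightarrow> 'n::finite state \<Rightarrow> bool" where
  "classical_solution \<alpha> \<beta> \<gamma> T = (\<lambda>(u, v, w).
     smooth_field T u \<and> smooth_field T v \<and> smooth_field T w \<and>
     (\<forall>t\<in>{0<..T}. \<forall>x.
        \<i> *s vector_derivative (\<lambda>\<tau>. u \<tau> x) (at t within {0..T}) + \<alpha> *\<^sub>R laplacian (u t) x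
          = - (divergence (w t) x *s v t x) \<and>
        \<i> *s vector_derivative (\<lambda>\<tau>. v \<tau> x) (at t within {0..T}) + \<beta> *\<^sub>R laplacian (v t) x
          = - (divergence (\<lambda>y. vcnj (w t y)) x *s u t x) \<and>
        \<i> *s vector_derivative (\<lambda>\<tau>. w \<tau> x) (at t within {0..T}) + \<gamma> *\<^sub>R laplacian (w t) x
          = gradient (\<lambda>y. cdot (u t y) (vcnj (v t y))) x))"

text \<open>The type argument \<open>'n\<close> only carries the dimension \<open>d = CARD('n)\<close>.\<close>

definition flow_map_discontinuous ::
    "'n::finite itself \<Rightarrow> real \<Rightarrow> real \<Rightarrow> real \<Rightarrow> real \<Rightarrow> bool" where
  "flow_map_discontinuous _ \<alpha> \<beta> \<gamma> s \<longleftrightarrow>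
     (\<forall>T>0. \<exists>(U :: 'n state) (V :: nat \<Rightarrow> 'n state).
        classical_solution \<alpha> \<beta> \<gamma> T U \<and> (\<forall>n. classical_solution \<alpha> \<beta> \<gamma> T (V n)) \<and>
        (\<lambda>n. state_dist s 0 (V n) U) \<longlonglongrightarrow> 0 \<and>
        \<not> (\<lambda>n. SUP t\<in>{0..T}. state_dist s t (V n) U) \<longlonglongrightarrow> 0)"

end

theory Submission
  imports Defs "HOL-Complex_Analysis.Cauchy_Integral_Formula" "HOL-Real_Asymp.Real_Asymp"
begin

text \<open>
  On fields \<open>u = p(t) e\<^sub>j\<close>, \<open>v = q(t) exp(i m x\<^sub>j) e\<^sub>j\<close>, \<open>w = r(t) exp(- i m x\<^sub>j) e\<^sub>j\<close> the system
  closes: the product \<open>(\<nabla> \<cdot> w) v\<close> does not depend on \<open>x\<close>, and the other two products stay in their modes.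
  Since \<open>\<beta> + \<gamma> = 0\<close>, the interaction is resonant, and with \<open>q = y exp(- i \<beta> m\<^sup>2 t)\<close> and
  \<open>r = - y exp(i \<beta> m\<^sup>2 t)\<close>, \<open>p\<close> and \<open>y\<close> real, the system becomes \<open>p' = - m y\<^sup>2\<close>, \<open>y' = m p y\<close>. Its
  solution \<open>p = - tanh(m (t - T))\<close>, \<open>y = 1 / cosh(m (t - T))\<close> leaves the equilibrium \<open>p = 1\<close>, \<open>y = 0\<close>:
  at time \<open>0\<close> it is exponentially close in \<open>m\<close> to the equilibrium, which beats any Sobolev weight,
  while at time \<open>T\<close> the mean of \<open>u\<close> is at distance \<open>1\<close> from it.
\<close>

section \<open>Integrals of exponentials over the period cube\<close>

lemma integral_lborel_prod:
  fixes f :: "'a::euclidean_space \<Rightarrow> real \<Rightarrow> complex"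
  assumes "\<And>b. b \<in> Basis \<Longrightarrow> integrable lborel (f b)"
  shows "(LINT x|lborel. (\<Prod>b\<in>Basis. f b (x \<bullet> b))) = (\<Prod>b\<in>Basis. LINT t|lborel. f b t)"
proof -
  interpret product_sigma_finite "\<lambda>_::'a. lborel :: real measure" by standard
  have [measurable]: "f b \<in> borel_measurable borel" if "b \<in> Basis" for b
    using borel_measurable_integrable[OF assms[OF that]] by simp
  \<comment> \<open>By \<open>lborel_eq\<close>, \<open>lborel\<close> is the image of a product of
    real lines under the map that assembles a vector from its coordinates; Fubini for finite
    products then applies.\<close>
  have "(LINT x|lborel. (\<Prod>b\<in>Basis. f b (x \<bullet> b))) =
      (LINT y|(\<Pi>\<^sub>M b\<in>(Basis::'a set). lborel).
         (\<Prod>b\<in>Basis. f b ((\<Sum>c\<in>Basis. y c *\<^sub>R c) \<bullet> b)))"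
    by (subst lborel_eq, subst integral_distr) auto
  also have "\<dots> = (LINT y|(\<Pi>\<^sub>M b\<in>(Basis::'a set). lborel). (\<Prod>b\<in>Basis. f b (y b)))"
    by (intro Bochner_Integration.integral_cong prod.cong refl) simp
  also have "\<dots> = (\<Prod>b\<in>Basis. LINT t|lborel. f b t)"
    by (rule product_integral_prod) (use assms in auto)
  finally show ?thesis .
qed

lemma integral_cis_period:
  assumes "l \<in> \<int>"
  shows "(LINT t|lborel. indicator {0..2 * pi} t *\<^sub>R cis (l * t)) = (if l = 0 then 2 * pi else 0)"
proof (cases "l = 0")
  case True
  have "(LINT t|lborel. indicator {0..2 * pi} t *\<^sub>R (1::complex)) = of_real (2 * pi) - of_real 0"
    by (rule integral_FTC_Icc) (auto intro!: derivative_eq_intros continuous_intros)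
  with True show ?thesis by simp
next
  case False
  have "(LINT t|lborel. indicator {0..2 * pi} t *\<^sub>R cis (l * t))
      = cis (l * (2 * pi)) / (\<i> * l) - cis (l * 0) / (\<i> * l)"
  proof (rule integral_FTC_Icc)
    fix t :: real
    show "((\<lambda>t. cis (l * t) / (\<i> * l)) has_vector_derivative cis (l * t)) (at t within {0..2 * pi})"
      using False
      by (auto intro!: derivative_eq_intros simp: scaleR_conv_of_real has_vector_derivative_def
          fun_eq_iff field_simps)
  qed (auto intro!: continuous_intros)
  \<comment> \<open>Integrality of \<open>l\<close> makes the primitive periodic, so its two
    endpoint values cancel.\<close>
  also have "cis (l * (2 * pi)) = 1"
    using assms cis_multiple_2pi[of l] by (simp add: mult_ac)
  finally show ?thesis using False by simp
qed

text \<open>Both the indicator of the cube and the exponential factor over the coordinates. A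
  nonzero \<open>l\<close> has a nonzero coordinate, whose one-dimensional factor vanishes.\<close>

lemma integral_cis_inner:
  fixes l :: "'a::euclidean_space"
  assumes "\<And>b. b \<in> Basis \<Longrightarrow> l \<bullet> b \<in> \<int>"
  shows "integral (cbox 0 ((2 * pi) *\<^sub>R One)) (\<lambda>x. cis (l \<bullet> x)) = (if l = 0 then (2 * pi) ^ DIM('a) else 0)"
proof -
  let ?C = "cbox 0 ((2 * pi) *\<^sub>R One) :: 'a set"
  have prod: "indicator ?C x *\<^sub>R cis (l \<bullet> x) =
      (\<Prod>b\<in>Basis. indicator {0..2 * pi} (x \<bullet> b) *\<^sub>R cis ((l \<bullet> b) * (x \<bullet> b)))" for x
  proof -
    have "cis (l \<bullet> x) = (\<Prod>b\<in>Basis. cis ((l \<bullet> b) * (x \<bullet> b)))"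
      unfolding cis_conv_exp euclidean_inner[of l x] by (simp add: sum_distrib_left exp_sum)
    moreover have "(indicator ?C x :: complex) = (\<Prod>b\<in>Basis. indicator {0..2 * pi} (x \<bullet> b))"
      by (cases "x \<in> ?C") (auto simp: mem_box indicator_def)
    ultimately show ?thesis
      by (simp add: prod.distrib scaleR_conv_of_real of_real_indicator)
  qed
  have "integral ?C (\<lambda>x. cis (l \<bullet> x)) = (LINT x:?C|lborel. cis (l \<bullet> x))"
    by (rule set_borel_integral_eq_integral(2)[symmetric])
      (auto simp: set_integrable_def intro!: borel_integrable_compact continuous_intros)
  also have "\<dots> = (\<Prod>b\<in>Basis. LINT t|lborel. indicator {0..2 * pi} t *\<^sub>R cis ((l \<bullet> b) * t))"
    unfolding set_lebesgue_integral_def prod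
    by (rule integral_lborel_prod) (auto intro!: borel_integrable_compact continuous_intros)
  also have "\<dots> = (\<Prod>b\<in>Basis. if l \<bullet> b = 0 then 2 * pi else 0)"
    using assms by (simp add: integral_cis_period)
  also have "\<dots> = (if l = 0 then (2 * pi) ^ DIM('a) else 0)"
    using euclidean_all_zero_iff[of l] by auto
  finally show ?thesis .
qed

section \<open>Single-mode fields, their Fourier coefficients and Sobolev norms\<close>

definition wave :: "'n \<Rightarrow> int \<Rightarrow> complex \<Rightarrow> real ^ 'n \<Rightarrow> complex ^ 'n" where
  "wave j m c x = (c * cis (m * x $ j)) *s axis j 1"

lemma wave_nth: "wave j m c x $ i = (if i = j then c * cis (m * x $ j) else 0)"
  by (simp add: wave_def axis_def)

lemma wave_diff: "wave j m c x - wave j m c' x = wave j m (c - c') x"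
  by (simp add: vec_eq_iff wave_nth algebra_simps)

lemma wave_zero [simp]: "wave j m 0 x = 0"
  by (simp add: vec_eq_iff wave_nth)

lemma bounded_linear_vector_smult: "bounded_linear (\<lambda>c. c *s (z :: complex ^ 'n))"
  by (intro linear_conv_bounded_linear[THEN iffD1] linearI)
    (simp_all add: vec_eq_iff algebra_simps)

text \<open>Orthogonality of the exponentials: the integrand is a fixed vector times the exponential
  of integer frequency \<open>axis j m - k\<close>, which has mean zero unless that frequency is
  zero.\<close>

lemma fourier_coeff_wave:
  "fourier_coeff (wave j m c) k = (if k = axis j m then c *s axis j 1 else 0)" for j :: "'n::finite"
proof -
  let ?l = "(\<chi> i. of_int ((axis j m - k) $ i)) :: real ^ 'n"
  let ?L = "\<lambda>z. (c * z) *s (axis j 1 :: complex ^ 'n)"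
  have L: "bounded_linear ?L"
    by (rule bounded_linear_compose[OF bounded_linear_vector_smult bounded_linear_mult_right])
  have box: "(\<chi> j. 2 * pi) = (2 * pi) *\<^sub>R (One :: real ^ 'n)"
  proof -
    have "(One :: real ^ 'n) $ i = 1" for i
      unfolding cart_eq_inner_axis
      by (simp add: inner_sum_left inner_Basis axis_in_Basis_iff cong: sum.cong_simp)
    thus ?thesis by (simp add: vec_eq_iff)
  qed
  have l0: "?l = 0 \<longleftrightarrow> k = axis j m"
    by (auto simp: vec_eq_iff)
  have eq: "cis (- (\<Sum>i\<in>UNIV. of_int (k $ i) * x $ i)) *s wave j m c x = ?L (cis (?l \<bullet> x))" for x
  proof -
    have "?l \<bullet> x = of_int m * x $ j - (\<Sum>i\<in>UNIV. of_int (k $ i) * x $ i)"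
    proof -
      have "(\<Sum>i\<in>UNIV. of_int (axis j m $ i) * x $ i) = (\<Sum>i\<in>UNIV. if i = j then of_int m * x $ j else 0)"
        by (intro sum.cong) (auto simp: axis_def)
      thus ?thesis by (simp add: inner_vec_def left_diff_distrib sum_subtractf)
    qed
    hence "cis (?l \<bullet> x) = cis (- (\<Sum>i\<in>UNIV. of_int (k $ i) * x $ i)) * cis (m * x $ j)"
      by (simp add: cis_mult)
    thus ?thesis by (simp add: wave_def mult_ac)
  qed
  have "\<forall>b\<in>Basis. ?l \<bullet> b \<in> \<int>"
    by (auto simp: Basis_vec_def inner_axis)
  hence I: "integral (cbox 0 (\<chi> j. 2 * pi)) (\<lambda>x. cis (?l \<bullet> x)) =
      (if k = axis j m then (2 * pi) ^ CARD('n) else 0)"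
    unfolding box l0[symmetric]
    by (subst integral_cis_inner) auto
  have "integral (cbox 0 (\<chi> j. 2 * pi)) (?L \<circ> (\<lambda>x. cis (?l \<bullet> x))) =
      ?L (integral (cbox 0 (\<chi> j. 2 * pi)) (\<lambda>x. cis (?l \<bullet> x)))"
    by (rule integral_linear[OF _ L]) (auto intro!: integrable_continuous continuous_intros)
  also have "\<dots> = ?L (if k = axis j m then (2 * pi) ^ CARD('n) else 0)"
    unfolding I ..
  finally have "fourier_coeff (wave j m c) k =
      (1 / (2 * pi) ^ CARD('n)) *\<^sub>R ?L (if k = axis j m then (2 * pi) ^ CARD('n) else 0)"
    unfolding fourier_coeff_def eq o_def by (rule arg_cong)
  also have "\<dots> = (if k = axis j m then c *s axis j 1 else 0)"
    by (simp add: vec_eq_iff axis_def, simp add: scaleR_conv_of_real)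
  finally show ?thesis .
qed

text \<open>Only the mode \<open>axis j m\<close> contributes, so the defining series has one term
  and converges for every real \<open>s\<close>.\<close>

lemma Hs_norm_wave:
  "Hs_norm s (wave j m c) = ennreal ((1 + (of_int m)\<^sup>2) powr (s / 2) * norm c)" for j :: "'n::finite"
proof -
  have "(\<Sum>i\<in>UNIV. (real_of_int (axis j m $ i))\<^sup>2) = (\<Sum>i\<in>UNIV. if i = j then (of_int m)\<^sup>2 else 0)"
    by (intro sum.cong) (auto simp: axis_def)
  hence ax: "(\<Sum>i\<in>UNIV. (real_of_int (axis j m $ i))\<^sup>2) = (of_int m)\<^sup>2" by simp
  have nrm: "norm (c *s (axis j 1 :: complex ^ 'n)) = norm c"
  proof -
    have "c *s (axis j 1 :: complex ^ 'n) = axis j c" by (simp add: vec_eq_iff axis_def)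
    thus ?thesis by (simp add: norm_eq_sqrt_inner inner_axis_axis)
  qed
  let ?W = "(1 + (of_int m)\<^sup>2) powr s * (norm c)\<^sup>2"
  have W: "sobolev_weight s (wave j m c) k = (if k = axis j m then ?W else 0)" for k
    by (simp add: sobolev_weight_def fourier_coeff_wave ax nrm)
  have "(sobolev_weight s (wave j m c) has_sum ?W) UNIV"
    by (rule has_sum_finite_neutralI[of "{axis j m}"]) (auto simp: W)
  hence "sobolev_weight s (wave j m c) summable_on UNIV"
    "(\<Sum>\<^sub>\<infinity>k. sobolev_weight s (wave j m c) k) = ?W"
    by (auto simp: summable_on_def infsumI)
  moreover have "sqrt ?W = (1 + (of_int m)\<^sup>2) powr (s / 2) * norm c"
    by (simp add: real_sqrt_mult powr_half_sqrt[symmetric] powr_powr)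
  ultimately show ?thesis by (simp add: Hs_norm_def)
qed

section \<open>Periodicity, differential operators and products on single modes\<close>

lemma torus_periodic_wave: "torus_periodic (wave j m c)"
proof -
  have "cis (of_int m * (t + 2 * pi)) = cis (of_int m * t)" for t
    using cis_multiple_2pi[of "of_int m"] by (simp add: distrib_left mult_ac flip: cis_mult)
  thus ?thesis
    by (auto simp: torus_periodic_def wave_def axis_def)
qed

text \<open>The map \<open>L\<close> lets one computation serve both vector-valued waves
  (\<open>L\<close> multiplies a fixed vector) and scalar functions or components (\<open>L\<close>
  is the identity or zero).\<close>

lemma partial_linear_cis:
  assumes "bounded_linear L"
  shows "partial i (\<lambda>x. L (c * cis (of_int m * x $ j))) x =
    L ((if i = j then \<i> * m * c else 0) * cis (of_int m * x $ j))"
  unfolding partial_def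
proof (rule vector_derivative_at)
  have shift: "(x + h *\<^sub>R axis i 1) $ j = x $ j + h * (if i = j then 1 else 0)" for h
    by (simp add: axis_def)
  have "((\<lambda>h. c * cis (of_int m * (x $ j + h * (if i = j then 1 else 0)))) has_vector_derivative
      (if i = j then \<i> * m * c else 0) * cis (of_int m * x $ j)) (at 0)"
    unfolding has_vector_derivative_def
    by (auto intro!: derivative_eq_intros simp: scaleR_conv_of_real fun_eq_iff)
  from bounded_linear.has_vector_derivative[OF assms this]
  show "((\<lambda>h. L (c * cis (of_int m * (x + h *\<^sub>R axis i 1) $ j))) has_vector_derivative
      L ((if i = j then \<i> * m * c else 0) * cis (of_int m * x $ j))) (at 0)"
    unfolding shift .
qed

lemma partial_wave: "partial i (wave j m c) = wave j m (if i = j then \<i> * m * c else 0)"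
  unfolding wave_def fun_eq_iff
  using partial_linear_cis[OF bounded_linear_vector_smult] by blast

lemma laplacian_wave: "laplacian (wave j m c) x = wave j m (- (of_int m)\<^sup>2 * c) x" for j :: "'n::finite"
proof -
  have "laplacian (wave j m c) x = (\<Sum>i\<in>UNIV. if i = j then wave j m (- (of_int m)\<^sup>2 * c) x else 0)"
    unfolding laplacian_def
    by (intro sum.cong) (auto simp: partial_wave power2_eq_square algebra_simps)
  thus ?thesis by simp
qed

text \<open>A wave is polarized along its own wave vector, so the derivative of its only component
  survives in full.\<close>

lemma divergence_wave: "divergence (wave j m c) x = \<i> * m * c * cis (m * x $ j)" for j :: "'n::finite"
proof -
  have p: "partial i (\<lambda>y. wave j m c y $ i) x = (if i = j then \<i> * m * c * cis (m * x $ j) else 0)" for i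
    using partial_linear_cis[OF bounded_linear_ident, of j c m j x]
      partial_linear_cis[OF bounded_linear_zero]
    by (auto simp: wave_nth)
  show ?thesis by (simp add: divergence_def p)
qed

lemma vcnj_wave: "vcnj (wave j m c x) = wave j (- m) (cnj c) x"
  by (simp add: vcnj_def vec_eq_iff wave_nth cis_cnj)

lemma cdot_wave: "cdot (wave j m c x) (wave j m' c' x) = c * c' * cis (of_int (m + m') * x $ j)"
  for j :: "'n::finite"
proof -
  have "cdot (wave j m c x) (wave j m' c' x) =
      (\<Sum>i\<in>UNIV. if i = j then c * c' * cis (of_int (m + m') * x $ j) else 0)"
    unfolding cdot_def by (intro sum.cong) (auto simp: wave_nth distrib_right simp flip: cis_mult)
  thus ?thesis by simp
qed

lemma gradient_cis: "gradient (\<lambda>y. c * cis (of_int m * y $ j)) x = wave j m (\<i> * m * c) x"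
  using partial_linear_cis[OF bounded_linear_ident, of _ c m j x]
  by (auto simp: gradient_def vec_eq_iff wave_nth)

section \<open>Joint smoothness in time and space for analytic amplitudes\<close>

lemma analytic_on_Reals_has_vector_derivative:
  assumes "f analytic_on \<real>"
  shows "((\<lambda>t. f (of_real t)) has_vector_derivative deriv f (of_real t)) (at t within S)"
proof (rule has_vector_derivative_real_field)
  show "(f has_field_derivative deriv f (of_real t)) (at (of_real t))"
    using analytic_on_imp_differentiable_at[OF assms Reals_of_real]
    by (simp add: DERIV_deriv_iff_field_differentiable)
qed

text \<open>The derivative in a direction \<open>(a, y)\<close> is written as a wave in the same
  mode with a new amplitude; this form lets differentiation be iterated.\<close>

lemma has_derivative_wave:
  assumes "f analytic_on \<real>"
  shows "((\<lambda>(t, x). wave j m (f (of_real t)) x) has_derivative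
     (\<lambda>(a, y). wave j m (of_real a * deriv f (of_real t) + \<i> * m * of_real (y $ j) * f (of_real t)) x))
     (at (t, x) within S)"
proof -
  have "((\<lambda>t. f (of_real t)) has_derivative (\<lambda>a. a *\<^sub>R deriv f (of_real t))) (at t)"
    using analytic_on_Reals_has_vector_derivative[OF assms] by (simp add: has_vector_derivative_def)
  hence f: "((\<lambda>p. f (of_real (fst p))) has_derivative (\<lambda>q. fst q *\<^sub>R deriv f (of_real t)))
      (at (t, x) within S)"
    using has_derivative_compose[OF has_derivative_fst[OF has_derivative_ident], of "\<lambda>t. f (of_real t)" _ "(t, x)"]
    by simp
  have n: "((\<lambda>p. snd p $ j) has_derivative (\<lambda>q. snd q $ j)) (at (t, x) within S)"
    by (intro bounded_linear_imp_has_derivative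
        bounded_linear_compose[OF bounded_linear_vec_nth bounded_linear_snd])
  have "((\<lambda>p. f (of_real (fst p)) * cis (of_int m * snd p $ j)) has_derivative
     (\<lambda>q. (of_real (fst q) * deriv f (of_real t) + \<i> * m * of_real (snd q $ j) * f (of_real t))
          * cis (of_int m * x $ j))) (at (t, x) within S)"
    by (rule derivative_eq_intros f n refl | simp)+
      (simp add: fun_eq_iff scaleR_conv_of_real algebra_simps)
  from bounded_linear.has_derivative[OF bounded_linear_vector_smult this]
  show ?thesis by (simp add: wave_def case_prod_unfold)
qed

text \<open>Induction on \<open>k\<close> over all amplitudes at once: a fixed direction turns
  \<open>f\<close> into a combination of \<open>f\<close> and \<open>deriv f\<close>, again analytic
  on \<open>\<real>\<close>.\<close>

lemma Ck_on_wave: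
  assumes "f analytic_on \<real>"
  shows "Ck_on k S (\<lambda>(t, x). wave j m (f (of_real t)) x)"
  using assms
proof (induction k arbitrary: f)
  case 0
  show ?case
    using has_derivative_continuous[OF has_derivative_wave[OF 0]]
    by (auto simp: continuous_on_eq_continuous_within)
next
  case (Suc k)
  let ?f' = "\<lambda>(t, x) (a, y). wave j m (of_real a * deriv f (of_real t) +
      \<i> * m * of_real (y $ j) * f (of_real t)) x"
  have "Ck_on k S (\<lambda>p. ?f' p h)" for h
  proof -
    have "(\<lambda>z. of_real (fst h) * deriv f z + \<i> * m * of_real (snd h $ j) * f z) analytic_on \<real>"
      by (intro analytic_intros analytic_deriv Suc.prems)
    from Suc.IH[OF this] show ?thesis by (simp add: case_prod_unfold)
  qed
  thus ?case
    using has_derivative_wave[OF Suc.prems]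
    by (auto intro!: exI[of _ ?f'])
qed

lemma smooth_field_wave:
  assumes "f analytic_on \<real>"
  shows "smooth_field T (\<lambda>t. wave j m (f (of_real t)))"
  using Ck_on_wave[OF assms] torus_periodic_wave
  by (auto simp: smooth_field_def smooth_on_def)

section \<open>Reduction of the system to ordinary differential equations\<close>

lemma vector_derivative_wave:
  assumes "(p has_vector_derivative p') (at t)" "0 < t" "t \<le> T"
  shows "vector_derivative (\<lambda>\<tau>. wave j m (p \<tau>) x) (at t within {0..T}) = wave j m p' x"
proof -
  have "((\<lambda>\<tau>. p \<tau> * cis (m * x $ j)) has_vector_derivative p' * cis (m * x $ j)) (at t)"
    by (rule has_vector_derivative_mult_left assms)+
  from bounded_linear.has_vector_derivative[OF bounded_linear_vector_smult this]
  \<comment> \<open>The amplitude is differentiable from both sides, so the one-sided derivative at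
    \<open>t = T\<close> agrees with \<open>p'\<close>.\<close>
  show ?thesis
    unfolding wave_def by (rule vector_derivative_at_within_ivl) (use assms in auto)
qed

text \<open>The modes \<open>0\<close>, \<open>m\<close>, \<open>- m\<close> are closed under the
  three products: \<open>- m + m = 0\<close>, \<open>m + 0 = m\<close>, \<open>0 - m = - m\<close>.
  Comparing amplitudes in each mode leaves the stated equations, the Laplacian acting as
  multiplication by \<open>- m\<^sup>2\<close> on the last two.\<close>

lemma classical_solution_wave:
  fixes j :: "'n::finite" and m :: int and \<alpha> \<beta> \<gamma> T :: real and p q r :: "complex \<Rightarrow> complex"
  assumes an: "p analytic_on \<real>" "q analytic_on \<real>" "r analytic_on \<real>"
    and p: "\<And>t::real. deriv p t = m * r t * q t"
    and q: "\<And>t::real. deriv q t = - \<i> * \<beta> * m\<^sup>2 * q t - m * cnj (r t) * p t"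
    and r: "\<And>t::real. deriv r t = - \<i> * \<gamma> * m\<^sup>2 * r t - m * p t * cnj (q t)"
  shows "classical_solution \<alpha> \<beta> \<gamma> T
    (\<lambda>t. wave j 0 (p (of_real t)), \<lambda>t. wave j m (q (of_real t)), \<lambda>t. wave j (- m) (r (of_real t)))"
proof -
  have d: "vector_derivative (\<lambda>\<tau>. wave j n (f (of_real \<tau>)) x) (at t within {0..T}) =
      wave j n (deriv f (of_real t)) x"
    if "f analytic_on \<real>" "0 < t" "t \<le> T" for f n t x
    by (rule vector_derivative_wave analytic_on_Reals_has_vector_derivative that)+
  show ?thesis
    unfolding classical_solution_def prod.case
  proof (intro conjI smooth_field_wave an ballI allI, goal_cases)
    case (1 t x)
    then show ?case
      by (simp add: d[OF an(1)] laplacian_wave divergence_wave p)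
        (simp add: vec_eq_iff wave_nth cis_mult)
  next
    case (2 t x)
    then show ?case
      by (simp only: d[OF an(2)] laplacian_wave divergence_wave vcnj_wave q greaterThanAtMost_iff)
        (simp add: vec_eq_iff wave_nth, simp add: scaleR_conv_of_real algebra_simps)
  next
    case (3 t x)
    then show ?case
      by (simp only: d[OF an(3)] laplacian_wave vcnj_wave cdot_wave gradient_cis r greaterThanAtMost_iff)
        (simp add: vec_eq_iff wave_nth, simp add: scaleR_conv_of_real algebra_simps)
  qed
qed

section \<open>The explicit hyperbolic solution and the equilibrium\<close>

lemma cosh_of_real: "cosh (of_real x :: complex) = of_real (cosh x)"
  by (simp add: cosh_field_def exp_of_real flip: of_real_minus)

lemma sinh_of_real: "sinh (of_real x :: complex) = of_real (sinh x)"
  by (simp add: sinh_field_def exp_of_real flip: of_real_minus)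

text \<open>Since \<gamma> = -\<beta>, the linear phases of the last two amplitudes are opposite and
  cancel in their product, leaving real equations. The free parameter \<open>t0\<close> is a time at
  which the first amplitude vanishes.\<close>

lemma classical_solution_soliton:
  fixes j :: "'n::finite" and m :: int and \<alpha> \<beta> \<gamma> T t0 :: real
  assumes "\<beta> + \<gamma> = 0"
  shows "classical_solution \<alpha> \<beta> \<gamma> T
    (\<lambda>t. wave j 0 (of_real (- tanh (m * (t - t0)))),
     \<lambda>t. wave j m (cis (- \<beta> * m\<^sup>2 * t) / of_real (cosh (m * (t - t0)))),
     \<lambda>t. wave j (- m) (- cis (\<beta> * m\<^sup>2 * t) / of_real (cosh (m * (t - t0)))))"
proof -
  let ?a = "\<lambda>z::complex. m * (z - of_real t0)"
  let ?p = "\<lambda>z. - (sinh (?a z) / cosh (?a z))"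
  let ?q = "\<lambda>z. exp (- \<i> * \<beta> * m\<^sup>2 * z) / cosh (?a z)"
  let ?r = "\<lambda>z. - (exp (\<i> * \<beta> * m\<^sup>2 * z) / cosh (?a z))"
  have a: "?a (of_real t) = of_real (m * (t - t0))" for t by simp
  have ch: "cosh (?a (of_real t)) = of_real (cosh (m * (t - t0)))"
    and sh: "sinh (?a (of_real t)) = of_real (sinh (m * (t - t0)))" for t
    by (simp_all only: a cosh_of_real sinh_of_real)
  have nz: "cosh (?a (of_real t)) \<noteq> 0" for t
    unfolding ch by simp
  \<comment> \<open>\<open>cosh\<close> has complex zeros, but none on the real axis; this is why
    amplitudes are only asked to be analytic on \<open>\<real>\<close>.\<close>
  have nz': "cosh (?a z) \<noteq> 0" if "z \<in> \<real>" for z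
    using that nz by (auto elim: Reals_cases)
  have E: "exp (- \<i> * \<beta> * m\<^sup>2 * of_real t) = cis (- \<beta> * m\<^sup>2 * t)"
    "exp (\<i> * \<beta> * m\<^sup>2 * of_real t) = cis (\<beta> * m\<^sup>2 * t)" for t
    by (simp_all add: cis_conv_exp mult_ac)
  have \<gamma>: "\<gamma> = - \<beta>" using assms by simp
  have "classical_solution \<alpha> \<beta> \<gamma> T
    (\<lambda>t. wave j 0 (?p (of_real t)), \<lambda>t. wave j m (?q (of_real t)), \<lambda>t. wave j (- m) (?r (of_real t)))"
  proof (rule classical_solution_wave)
    show "?p analytic_on \<real>" "?q analytic_on \<real>" "?r analytic_on \<real>"
      by (intro analytic_intros nz'; assumption)+
  next
    fix t :: real
    let ?z = "complex_of_real t"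
    have "(?p has_field_derivative - (m * ((cosh (?a ?z))\<^sup>2 - (sinh (?a ?z))\<^sup>2)) / (cosh (?a ?z))\<^sup>2) (at ?z)"
      using nz[of t] by (auto intro!: derivative_eq_intros simp: power2_eq_square field_simps)
    moreover have "?r ?z * ?q ?z = - 1 / (cosh (?a ?z))\<^sup>2"
      by (simp add: power2_eq_square flip: exp_add)
    ultimately show "deriv ?p ?z = m * ?r ?z * ?q ?z"
      by (simp only: hyperbolic_pythagoras mult.assoc DERIV_imp_deriv) simp
  next
    fix t :: real
    let ?z = "complex_of_real t"
    have "(?q has_field_derivative - \<i> * \<beta> * m\<^sup>2 * ?q ?z -
        m * exp (- \<i> * \<beta> * m\<^sup>2 * ?z) * sinh (?a ?z) / (cosh (?a ?z))\<^sup>2) (at ?z)"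
      using nz[of t] by (auto intro!: derivative_eq_intros simp: power2_eq_square field_simps)
    \<comment> \<open>Conjugation is not holomorphic, so this relation is used only at real times,
      where \<open>cosh\<close> is real and conjugation reverses the phase.\<close>
    moreover have "cnj (?r ?z) = - ?q ?z"
      unfolding ch E by (simp add: cis_cnj)
    ultimately show "deriv ?q ?z = - \<i> * \<beta> * m\<^sup>2 * ?q ?z - m * cnj (?r ?z) * ?p ?z"
      by (simp add: DERIV_imp_deriv power2_eq_square)
  next
    fix t :: real
    let ?z = "complex_of_real t"
    have "(?r has_field_derivative \<i> * \<beta> * m\<^sup>2 * ?r ?z +
        m * exp (\<i> * \<beta> * m\<^sup>2 * ?z) * sinh (?a ?z) / (cosh (?a ?z))\<^sup>2) (at ?z)"
      using nz[of t] by (auto intro!: derivative_eq_intros simp: power2_eq_square field_simps)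
    moreover have "cnj (?q ?z) = - ?r ?z"
      unfolding ch E by (simp add: cis_cnj)
    ultimately show "deriv ?r ?z = - \<i> * \<gamma> * m\<^sup>2 * ?r ?z - m * ?p ?z * cnj (?q ?z)"
      by (simp add: DERIV_imp_deriv power2_eq_square \<gamma>)
  qed
  thus ?thesis
    by (simp only: ch sh E) (simp add: tanh_def)
qed

lemma classical_solution_constant:
  "classical_solution \<alpha> \<beta> \<gamma> T (\<lambda>t. wave j 0 c, \<lambda>t. wave j m 0, \<lambda>t. wave j (- m) 0)"
  using classical_solution_wave[of "\<lambda>_. c" "\<lambda>_. 0" "\<lambda>_. 0" m \<beta> \<gamma> \<alpha> T j] by simp

theorem theorem1p11:
  fixes \<alpha> \<beta> \<gamma> s :: real
  assumes "\<alpha> \<noteq> 0" and "\<beta> \<noteq> 0" and "\<gamma> \<noteq> 0"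
    and "\<beta> + \<gamma> = 0"
  shows "flow_map_discontinuous TYPE('n::finite) \<alpha> \<beta> \<gamma> s"
  unfolding flow_map_discontinuous_def
proof (intro allI impI)
  fix T :: real
  assume T: "T > 0"
  fix j :: 'n
  \<comment> \<open>The modes of the zero components are immaterial; \<open>- 0\<close> matches
    \<open>classical_solution_constant\<close> at \<open>m = 0\<close>.\<close>
  define U :: "'n state" where "U = (\<lambda>t. wave j 0 1, \<lambda>t. wave j 0 0, \<lambda>t. wave j (- 0) 0)"
  \<comment> \<open>The frequency is \<open>n\<close> and \<open>t0 = T\<close>: growing
    \<open>n\<close> pushes the data at time \<open>0\<close> towards \<open>U\<close>, while the
    first amplitude is \<open>0\<close> at time \<open>T\<close> for every \<open>n\<close>.\<close>
  define V :: "nat \<Rightarrow> 'n state" where "V n =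
    (\<lambda>t. wave j 0 (of_real (- tanh (int n * (t - T)))),
     \<lambda>t. wave j (int n) (cis (- \<beta> * (int n)\<^sup>2 * t) / of_real (cosh (int n * (t - T)))),
     \<lambda>t. wave j (- int n) (- cis (\<beta> * (int n)\<^sup>2 * t) / of_real (cosh (int n * (t - T)))))" for n
  \<comment> \<open>The mean mode has Sobolev weight \<open>1\<close>; the other two differences
    have equal norms because their phases are unimodular, hence the factor \<open>2\<close>.\<close>
  have dist: "state_dist s t (V n) U = ennreal (\<bar>tanh (n * (t - T)) + 1\<bar>
      + 2 * ((1 + (real n)\<^sup>2) powr (s / 2) / cosh (n * (t - T))))" for t n
  proof -
    have "\<bar>- tanh (n * (t - T)) - 1\<bar> = \<bar>tanh (n * (t - T)) + 1\<bar>" by linarith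
    hence "norm (complex_of_real (- tanh (n * (t - T))) - 1) = \<bar>tanh (n * (t - T)) + 1\<bar>"
      by (metis norm_of_real of_real_1 of_real_diff)
    thus ?thesis
      by (simp add: state_dist_def U_def V_def wave_diff Hs_norm_wave norm_divide flip: ennreal_plus)
  qed
  have "(\<lambda>n. state_dist s 0 (V n) U) \<longlonglongrightarrow> ennreal 0"
    unfolding dist
  proof (rule tendsto_ennrealI)
    \<comment> \<open>The first term decays like \<open>exp (- 2 * n * T)\<close>; in the second, a
      factor of order \<open>exp (- n * T)\<close> beats a weight of order
      \<open>n powr s\<close>.\<close>
    show "(\<lambda>n. \<bar>tanh (real n * (0 - T)) + 1\<bar>
      + 2 * ((1 + (real n)\<^sup>2) powr (s / 2) / cosh (real n * (0 - T)))) \<longlonglongrightarrow> 0"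
      using T by real_asymp
  qed
  moreover have "\<not> (\<lambda>n. SUP t\<in>{0..T}. state_dist s t (V n) U) \<longlonglongrightarrow> 0"
  proof
    assume "(\<lambda>n. SUP t\<in>{0..T}. state_dist s t (V n) U) \<longlonglongrightarrow> 0"
    moreover have "1 \<le> (SUP t\<in>{0..T}. state_dist s t (V n) U)" for n
    proof -
      \<comment> \<open>At \<open>t = T\<close> the \<open>tanh\<close> term is zero, so the mean
        alone contributes \<open>1\<close>.\<close>
      have "1 \<le> state_dist s T (V n) U" by (simp add: dist)
      also have "\<dots> \<le> (SUP t\<in>{0..T}. state_dist s t (V n) U)"
        using T by (intro SUP_upper) auto
      finally show ?thesis .
    qed
    ultimately have "1 \<le> (0 :: ennreal)"
      by (intro LIMSEQ_le_const) auto
    thus False by simp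
  qed
  moreover have "classical_solution \<alpha> \<beta> \<gamma> T U" "classical_solution \<alpha> \<beta> \<gamma> T (V n)" for n
    unfolding U_def V_def
    by (rule classical_solution_constant classical_solution_soliton assms)+
  ultimately show "\<exists>(U :: 'n state) (V :: nat \<Rightarrow> 'n state).
      classical_solution \<alpha> \<beta> \<gamma> T U \<and> (\<forall>n. classical_solution \<alpha> \<beta> \<gamma> T (V n)) \<and>
      (\<lambda>n. state_dist s 0 (V n) U) \<longlonglongrightarrow> 0 \<and>
      \<not> (\<lambda>n. SUP t\<in>{0..T}. state_dist s t (V n) U) \<longlonglongrightarrow> 0"
    by (intro exI[of _ U] exI[of _ V]) simp
qed

end
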